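(* Let $X$ be a Hilbert space, let $\varphi: X\to\overline{\mathbb{R}}$ be a proper, prox-bounded, and lower semicontinuous function, let $\bar{x}\in\operatorname{dom}\varphi$, and let $\sigma>0$. Consider the following assertions: (i) $\bar{x}$ is a strong local minimizer of $\varphi$ with modulus $\sigma$. (ii) For all $\lambda>0$ sufficiently small, $\bar{x}$ is a strong local minimizer of the Moreau envelope $e_\lambda\varphi$ with modulus $\dfrac{\sigma}{1+\sigma\lambda}$. Then (i) implies (ii) if $\varphi$ is weakly sequentially lower semicontinuous. The reverse implication, that (ii) implies (i), holds if $P_\lambda\varphi(\bar{x})\neq\emptyset$ for all small $\lambda>0$; in particular, it holds when $\varphi$ is weakly sequentially lower semicontinuous on $X$.
   Context: Here $\overline{\mathbb{R}}=(-\infty,\infty]$ and $\operatorname{dom}\varphi=\{x\in X:\varphi(x)<\infty\}$; $\varphi$ is proper if $\operatorname{dom}\varphi\ne\emptyset$. $B_r(x)$ denotes the open ball centered at $x$ with radius $r>0$. For $\lambda>0$ and $x\in X$, the Moreau envelope and the proximal mapping of $\varphi$ are $$e_\lambda\varphi(x):=\inf_{w\in X}\Big\{\varphi(w)+\frac{1}{2\lambda}\|w-x\|^2\Big\},\qquad P_\lambda\varphi(x):=\operatorname{argmin}_{w\in X}\Big\{\varphi(w)+\frac{1}{2\lambda}\|w-x\|^2\Big\}.$$ The function $\varphi$ is prox-bounded if there exist $\alpha,\beta\in\mathbb{R}$ and $z\in X$ with $\varphi(x)\ge\alpha\|x-z\|^2+\beta$ for all $x\in X$. The function $\varphi$ is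 weakly sequentially lower semicontinuous if $\liminf_{k\to\infty}\varphi(x_k)\ge\varphi(x)$ for every $x\in X$ and every sequence $\{x_k\}$ converging weakly to $x$; equivalently, all level sets $\{x\in X:\varphi(x)\le\alpha\}$, $\alpha\in\mathbb{R}$, are weakly sequentially closed. A point $\bar{x}$ is a strong local minimizer of a function $f$ (with $f(\bar{x})$ finite) with modulus $\mu>0$ if there is $\varepsilon>0$ such that $f(x)\ge f(\bar{x})+\frac{\mu}{2}\|x-\bar{x}\|^2$ for all $x\in B_\varepsilon(\bar{x})$. In (ii), the radius $\varepsilon$ may depend on $\lambda$. *)

theory Defs
  imports "HOL-Analysis.Analysis"
begin

text \<open>
  Functions with values in \<open>(-\<infinity>, \<infinity>]\<close> are rendered as \<^typ>\<open>ereal\<close>-valued functions that never take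
  the value \<open>-\<infinity>\<close>; that requirement is a separate hypothesis, because a Moreau envelope may
  take the value \<open>-\<infinity>\<close>.
\<close>

definition dom_ext :: "('a \<Rightarrow> ereal) \<Rightarrow> 'a set" where
  "dom_ext f = {x. f x < \<infinity>}"

definition proper_fun :: "('a \<Rightarrow> ereal) \<Rightarrow> bool" where
  "proper_fun f \<longleftrightarrow> dom_ext f \<noteq> {}"

definition prox_bounded :: "('a::real_normed_vector \<Rightarrow> ereal) \<Rightarrow> bool" where
  "prox_bounded f \<longleftrightarrow>
     (\<exists>(\<alpha>::real) (\<beta>::real) z. \<forall>x. f x \<ge> ereal (\<alpha> * (norm (x - z))\<^sup>2 + \<beta>))"

definition lower_semicontinuous :: "('a::topological_space \<Rightarrow> ereal) \<Rightarrow> bool" where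
  "lower_semicontinuous f \<longleftrightarrow> (\<forall>x. f x \<le> Liminf (at x) f)"

text \<open>
  In a Hilbert space the continuous linear functionals are exactly the maps \<open>u \<mapsto> u \<bullet> y\<close>, so weak
  convergence is convergence of all inner products.
\<close>

definition weakly_converges_to :: "(nat \<Rightarrow> 'a::real_inner) \<Rightarrow> 'a \<Rightarrow> bool" where
  "weakly_converges_to s x \<longleftrightarrow> (\<forall>y. (\<lambda>k. s k \<bullet> y) \<longlonglongrightarrow> x \<bullet> y)"

definition weakly_seq_lsc :: "('a::real_inner \<Rightarrow> ereal) \<Rightarrow> bool" where
  "weakly_seq_lsc f \<longleftrightarrow>
     (\<forall>x s. weakly_converges_to s x \<longrightarrow> liminf (\<lambda>k. f (s k)) \<ge> f x)"

definition moreau_env :: "real \<Rightarrow> ('a::real_normed_vector \<Rightarrow> ereal) \<Rightarrow> 'a \<Rightarrow> ereal" where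
  "moreau_env l f x = (INF w. f w + ereal (1 / (2 * l) * (norm (w - x))\<^sup>2))"

definition prox_map :: "real \<Rightarrow> ('a::real_normed_vector \<Rightarrow> ereal) \<Rightarrow> 'a \<Rightarrow> 'a set" where
  "prox_map l f x =
     {w. is_arg_min (\<lambda>w. f w + ereal (1 / (2 * l) * (norm (w - x))\<^sup>2)) (\<lambda>_. True) w}"

definition strong_local_min ::
    "('a::real_normed_vector \<Rightarrow> ereal) \<Rightarrow> 'a \<Rightarrow> real \<Rightarrow> bool" where
  "strong_local_min f xb \<mu> \<longleftrightarrow>
     \<mu> > 0 \<and> \<bar>f xb\<bar> \<noteq> \<infinity> \<and>
     (\<exists>\<epsilon>>0. \<forall>x\<in>ball xb \<epsilon>. f x \<ge> f xb + ereal (\<mu> / 2 * (norm (x - xb))\<^sup>2))"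

end

theory Submission
  imports Defs
begin

text \<open>
  If \<open>f w \<ge> f xb + \<sigma>/2 \<parallel>w - xb\<parallel>\<^sup>2\<close> near \<open>xb\<close>, then the infimal convolution of the two quadratics
  gives the modulus \<open>\<sigma> / (1 + \<sigma> \<lambda>)\<close> for the envelope; prox-boundedness shows that for small \<open>\<lambda>\<close> the
  points \<open>w\<close> far from \<open>xb\<close> do not matter.

  Conversely, if \<open>xb\<close> is a local minimizer of the envelope, then \<open>e\<^sub>\<lambda> f xb = f xb\<close>: moving from \<open>xb\<close>
  towards an almost optimal \<open>w\<close> decreases the envelope by an amount controlled from below by
  \<open>\<parallel>w - xb\<parallel>\<close>, so minimizing sequences converge in norm to \<open>xb\<close>, and lower semicontinuity applies.
  Then \<open>f x \<ge> e\<^sub>\<lambda> f y - \<parallel>x - y\<parallel>\<^sup>2 / (2 \<lambda>)\<close> with \<open>y = xb + (1 + \<sigma> \<lambda>) (x - xb)\<close> recovers the modulus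
  \<open>\<sigma>\<close>.
\<close>

lemma moreau_env_le: "moreau_env l f x \<le> f w + ereal (1 / (2 * l) * (norm (w - x))\<^sup>2)"
  unfolding moreau_env_def by (rule INF_lower) simp

lemma moreau_env_le_self: "moreau_env l f x \<le> f x"
  using moreau_env_le[of l f x x] by simp

text \<open>After multiplication by \<open>2 * l * (1 + \<sigma> * l)\<close> the gap between the
  two sides is the square \<open>(\<sigma> * l * p - q)\<^sup>2\<close>. Equality therefore holds
  exactly at \<open>q = \<sigma> * l * p\<close>.\<close>

lemma quadratic_inf_convolution_le:
  fixes \<sigma> l p q :: real
  assumes "\<sigma> > 0" "l > 0"
  shows "\<sigma> / (1 + \<sigma> * l) / 2 * (p + q)\<^sup>2 \<le> \<sigma> / 2 * p\<^sup>2 + 1 / (2 * l) * q\<^sup>2"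
proof -
  define m where "m = 1 + \<sigma> * l"
  have m: "m > 0" using assms by (simp add: m_def add_pos_pos)
  have "m * (\<sigma> * l * p\<^sup>2 + q\<^sup>2) - \<sigma> * l * (p + q)\<^sup>2 = (\<sigma> * l * p - q)\<^sup>2"
    by (simp add: m_def power2_eq_square algebra_simps)
  then have le: "\<sigma> * l * (p + q)\<^sup>2 \<le> m * (\<sigma> * l * p\<^sup>2 + q\<^sup>2)"
    using zero_le_power2[of "\<sigma> * l * p - q"] by linarith
  have "\<sigma> / m / 2 * (p + q)\<^sup>2 = \<sigma> * l * (p + q)\<^sup>2 / (2 * l * m)"
    using assms m by simp
  also have "\<dots> \<le> m * (\<sigma> * l * p\<^sup>2 + q\<^sup>2) / (2 * l * m)"
    using le assms m by (intro divide_right_mono) auto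
  also have "\<dots> = \<sigma> / 2 * p\<^sup>2 + 1 / (2 * l) * q\<^sup>2"
    using assms m by (simp add: field_simps)
  finally show ?thesis unfolding m_def .
qed

text \<open>Recentres the quadratic bound at an arbitrary point. Passing from \<open>z\<close> to
  \<open>y\<close> by the triangle inequality and (s + t)^2 \<le> 2 s^2 + 2 t^2 doubles the
  curvature and moves the rest into the constant.\<close>

lemma prox_bounded_quadratic_minorant:
  fixes f :: "'a::real_normed_vector \<Rightarrow> ereal"
  assumes "prox_bounded f"
  obtains a b where "a \<ge> 0" "\<And>x. f x \<ge> ereal (- a * (norm (x - y))\<^sup>2 - b)"
proof -
  obtain \<alpha> \<beta> z where bd: "\<And>x. f x \<ge> ereal (\<alpha> * (norm (x - z))\<^sup>2 + \<beta>)"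
    using assms unfolding prox_bounded_def by blast
  define b where "b = 2 * \<bar>\<alpha>\<bar> * (norm (y - z))\<^sup>2 - \<beta>"
  have "f x \<ge> ereal (- (2 * \<bar>\<alpha>\<bar>) * (norm (x - y))\<^sup>2 - b)" for x
  proof -
    have "norm (x - z) \<le> norm (x - y) + norm (y - z)"
      using norm_triangle_ineq[of "x - y" "y - z"] by simp
    then have "(norm (x - z))\<^sup>2 \<le> (norm (x - y) + norm (y - z))\<^sup>2"
      by (simp add: power_mono)
    also have "\<dots> \<le> 2 * (norm (x - y))\<^sup>2 + 2 * (norm (y - z))\<^sup>2"
      using sum_squares_ge_zero[of "norm (x - y) - norm (y - z)" 0]
      by (simp add: power2_eq_square algebra_simps)
    finally have "\<bar>\<alpha>\<bar> * (norm (x - z))\<^sup>2 \<le> \<bar>\<alpha>\<bar> * (2 * (norm (x - y))\<^sup>2 + 2 * (norm (y - z))\<^sup>2)"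
      by (simp add: mult_left_mono)
    moreover have "- (\<bar>\<alpha>\<bar> * (norm (x - z))\<^sup>2) \<le> \<alpha> * (norm (x - z))\<^sup>2"
      using mult_right_mono[of "- \<bar>\<alpha>\<bar>" \<alpha> "(norm (x - z))\<^sup>2"] by simp
    ultimately have "- (2 * \<bar>\<alpha>\<bar>) * (norm (x - y))\<^sup>2 - b \<le> \<alpha> * (norm (x - z))\<^sup>2 + \<beta>"
      unfolding b_def by (simp add: algebra_simps)
    then show ?thesis using bd[of x] order_trans ereal_less_eq(3) by blast
  qed
  then show thesis using that[of "2 * \<bar>\<alpha>\<bar>" b] by simp
qed

lemma strong_local_min_moreau_env:
  fixes f :: "'a::real_normed_vector \<Rightarrow> ereal"
  assumes "prox_bounded f" "strong_local_min f xb \<sigma>"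
  shows "\<forall>\<^sub>F l in at_right 0. strong_local_min (moreau_env l f) xb (\<sigma> / (1 + \<sigma> * l))"
proof -
  obtain \<epsilon> where \<sigma>: "\<sigma> > 0" and fin: "\<bar>f xb\<bar> \<noteq> \<infinity>" and \<epsilon>: "\<epsilon> > 0"
    and grow: "\<And>x. x \<in> ball xb \<epsilon> \<Longrightarrow> f x \<ge> f xb + ereal (\<sigma> / 2 * (norm (x - xb))\<^sup>2)"
    using assms(2) unfolding strong_local_min_def by metis
  obtain f0 where f0: "f xb = ereal f0" using fin by (cases "f xb") auto
  obtain a b where a: "a \<ge> 0" and bd: "\<And>x. f x \<ge> ereal (- a * (norm (x - xb))\<^sup>2 - b)"
    using prox_bounded_quadratic_minorant[OF assms(1)] by metis
  \<comment> \<open>\<open>C - b\<close> bounds the values that the target quadratic takes on the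
    ball of radius \<open>\<epsilon> / 2\<close>. Dividing \<open>C\<close> by
    \<open>\<epsilon>\<^sup>2\<close> absorbs it into a quadratic term, so that K p^2 \<ge> a p^2 +
    C whenever p \<ge> \<epsilon>.\<close>
  define C where "C = \<bar>f0 + \<sigma> / 8 * \<epsilon>\<^sup>2 + b\<bar>"
  define K where "K = a + C / \<epsilon>\<^sup>2"
  have C: "C \<ge> 0" "f0 + \<sigma> / 8 * \<epsilon>\<^sup>2 + b \<le> C" unfolding C_def by auto
  have K: "K \<ge> 0" unfolding K_def using a C \<epsilon> by simp
  have step: "strong_local_min (moreau_env l f) xb (\<sigma> / (1 + \<sigma> * l))"
    \<comment> \<open>The factor 8 arises because far points satisfy q \<ge> p / 2, whence q^2 / (2
      l) \<ge> p^2 / (8 l) \<ge> K p^2. Writing \<open>K + 1\<close> keeps the threshold meaningful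
      when \<open>K = 0\<close>.\<close>
    if l: "l > 0" "l < 1 / (8 * (K + 1))" for l
  proof -
    have lK: "K \<le> 1 / (8 * l)"
      using l K by (simp add: field_simps)
    have env: "moreau_env l f x \<ge> ereal (f0 + \<sigma> / (1 + \<sigma> * l) / 2 * (norm (x - xb))\<^sup>2)"
      if x: "x \<in> ball xb (\<epsilon> / 2)" for x
      unfolding moreau_env_def
    proof (rule INF_greatest)
      fix w
      let ?p = "norm (w - xb)" and ?q = "norm (w - x)" and ?r = "norm (x - xb)"
      have r: "?r < \<epsilon> / 2" using x by (simp add: dist_norm norm_minus_commute)
      have tri: "?r \<le> ?p + ?q" "?p \<le> ?q + ?r"
        using norm_triangle_ineq4[of "w - xb" "w - x"] norm_triangle_ineq[of "w - x" "x - xb"]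
        by simp_all
      have m: "\<sigma> / (1 + \<sigma> * l) / 2 \<ge> 0" "\<sigma> / (1 + \<sigma> * l) / 2 \<le> \<sigma> / 2"
        using \<sigma> l by (simp_all add: divide_le_eq add_pos_pos)
      \<comment> \<open>A real minorant \<open>c\<close> of \<open>f w\<close> keeps the estimates
        in the reals, even where \<open>f w\<close> is infinite.\<close>
      have "\<exists>c. ereal c \<le> f w \<and>
          f0 + \<sigma> / (1 + \<sigma> * l) / 2 * ?r\<^sup>2 \<le> c + 1 / (2 * l) * ?q\<^sup>2"
      proof (cases "?p < \<epsilon>")
        case True
        have "\<sigma> / (1 + \<sigma> * l) / 2 * ?r\<^sup>2 \<le> \<sigma> / (1 + \<sigma> * l) / 2 * (?p + ?q)\<^sup>2"
          using tri by (intro mult_left_mono power_mono m) auto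
        also have "\<dots> \<le> \<sigma> / 2 * ?p\<^sup>2 + 1 / (2 * l) * ?q\<^sup>2"
          by (rule quadratic_inf_convolution_le[OF \<sigma> l(1)])
        finally have "f0 + \<sigma> / (1 + \<sigma> * l) / 2 * ?r\<^sup>2
            \<le> (f0 + \<sigma> / 2 * ?p\<^sup>2) + 1 / (2 * l) * ?q\<^sup>2" by simp
        moreover have "ereal (f0 + \<sigma> / 2 * ?p\<^sup>2) \<le> f w"
          using grow[of w] True by (simp add: f0 dist_norm norm_minus_commute)
        ultimately show ?thesis by blast
      next
        case False
        have "\<sigma> / (1 + \<sigma> * l) / 2 * ?r\<^sup>2 \<le> \<sigma> / 2 * (\<epsilon> / 2)\<^sup>2"
          using \<sigma> r by (intro mult_mono power_mono m) auto
        also have "\<dots> = \<sigma> / 8 * \<epsilon>\<^sup>2" by (simp add: power2_eq_square)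
        finally have 1: "f0 + \<sigma> / (1 + \<sigma> * l) / 2 * ?r\<^sup>2 \<le> C - b"
          using C(2) by linarith
        have "C = C / \<epsilon>\<^sup>2 * \<epsilon>\<^sup>2" using \<epsilon> by simp
        also have "\<dots> \<le> C / \<epsilon>\<^sup>2 * ?p\<^sup>2"
          using False \<epsilon> C by (intro mult_left_mono power_mono) auto
        also have "\<dots> = K * ?p\<^sup>2 - a * ?p\<^sup>2" by (simp add: K_def algebra_simps)
        also have "\<dots> \<le> 1 / (8 * l) * ?p\<^sup>2 - a * ?p\<^sup>2"
          using mult_right_mono[OF lK, of "?p\<^sup>2"] by simp
        also have "1 / (8 * l) * ?p\<^sup>2 = 1 / (2 * l) * (?p / 2)\<^sup>2" by (simp add: power2_eq_square)
        \<comment> \<open>Here p \<ge> \<epsilon> and r < \<epsilon> / 2 \<le> p / 2, so q \<ge> p -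
          r \<ge> p / 2.\<close>
        also have "\<dots> \<le> 1 / (2 * l) * ?q\<^sup>2"
          using False r tri l by (intro mult_left_mono power_mono) auto
        finally have "f0 + \<sigma> / (1 + \<sigma> * l) / 2 * ?r\<^sup>2
            \<le> (- a * ?p\<^sup>2 - b) + 1 / (2 * l) * ?q\<^sup>2" using 1 by linarith
        then show ?thesis using bd[of w] by blast
      qed
      then obtain c where c: "ereal c \<le> f w"
        "f0 + \<sigma> / (1 + \<sigma> * l) / 2 * ?r\<^sup>2 \<le> c + 1 / (2 * l) * ?q\<^sup>2" by blast
      have "ereal (f0 + \<sigma> / (1 + \<sigma> * l) / 2 * ?r\<^sup>2) \<le> ereal c + ereal (1 / (2 * l) * ?q\<^sup>2)"
        using c(2) by simp
      also have "\<dots> \<le> f w + ereal (1 / (2 * l) * ?q\<^sup>2)"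
        using c(1) by (rule add_right_mono)
      finally show "ereal (f0 + \<sigma> / (1 + \<sigma> * l) / 2 * ?r\<^sup>2)
          \<le> f w + ereal (1 / (2 * l) * ?q\<^sup>2)" .
    qed
    have "moreau_env l f xb = ereal f0"
      using env[of xb] \<epsilon> moreau_env_le_self[of l f xb] by (simp add: f0)
    moreover have "\<sigma> / (1 + \<sigma> * l) > 0" using \<sigma> l by (simp add: add_pos_pos)
    ultimately show ?thesis
      unfolding strong_local_min_def using env \<epsilon>
      by (intro conjI exI[of _ "\<epsilon> / 2"]) auto
  qed
  have "\<forall>\<^sub>F l in at_right 0. l \<in> {0<..<1 / (8 * (K + 1))}"
    using K by (intro eventually_at_right_real) simp
  then show ?thesis by eventually_elim (use step in auto)
qed

lemma lower_semicontinuous_ball: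
  fixes f :: "'a::metric_space \<Rightarrow> ereal"
  assumes "lower_semicontinuous f" "c < f x"
  obtains \<delta> where "\<delta> > 0" "\<And>w. dist w x < \<delta> \<Longrightarrow> c < f w"
proof -
  have "c < Liminf (at x) f"
    using assms unfolding lower_semicontinuous_def by (metis order_less_le_trans)
  then have "\<forall>\<^sub>F w in at x. c < f w" by (rule less_LiminfD)
  then obtain \<delta> where "\<delta> > 0" "\<And>w. w \<noteq> x \<Longrightarrow> dist w x < \<delta> \<Longrightarrow> c < f w"
    unfolding eventually_at by blast
  \<comment> \<open>\<open>at x\<close> ignores \<open>x\<close> itself; the centre is covered by
    the assumption \<open>c < f x\<close>.\<close>
  then show thesis using that assms(2) by metis
qed

lemma moreau_env_eq_at_local_min:
  fixes f :: "'a::real_normed_vector \<Rightarrow> ereal"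
  assumes lsc: "lower_semicontinuous f" and l: "l > 0" and \<epsilon>: "\<epsilon> > 0"
    and fin: "\<bar>moreau_env l f xb\<bar> \<noteq> \<infinity>"
    and min: "\<And>x. x \<in> ball xb \<epsilon> \<Longrightarrow> moreau_env l f xb \<le> moreau_env l f x"
  shows "moreau_env l f xb = f xb"
proof (rule antisym[OF moreau_env_le_self], rule ccontr)
  assume "\<not> f xb \<le> moreau_env l f xb"
  then have less: "moreau_env l f xb < f xb" by simp
  obtain e where e: "moreau_env l f xb = ereal e" using fin by (cases "moreau_env l f xb") auto
  obtain c where c: "ereal e < ereal c" "ereal c < f xb"
    using ereal_dense2[of "ereal e" "f xb"] less e by auto
  obtain \<delta> where \<delta>: "\<delta> > 0" and near: "\<And>w. dist w xb < \<delta> \<Longrightarrow> ereal c < f w"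
    using lower_semicontinuous_ball[OF lsc c(2)] by blast
  \<comment> \<open>\<open>s\<close> is the length of the step from \<open>xb\<close> towards
    \<open>w\<close>: below \<open>\<epsilon>\<close> so that local minimality applies at its end,
    below \<open>\<delta>\<close> so that it stops short of \<open>w\<close>.\<close>
  define s where "s = min \<delta> \<epsilon> / 2"
  have s: "s > 0" "s < \<epsilon>" "s < \<delta>" using \<delta> \<epsilon> unfolding s_def by auto
  \<comment> \<open>The bound \<open>c - e\<close> forces \<open>f w \<le> c\<close> and hence
    \<open>w\<close> outside the \<open>\<delta>\<close>-ball. The other bound is a decrease of the
    quadratic term guaranteed by the step, which contradicts near-optimality of
    \<open>w\<close>.\<close>
  define \<eta> where "\<eta> = min (c - e) (s * \<delta> / (2 * l))"
  have "\<eta> > 0" using c s \<delta> l by (simp add: \<eta>_def)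
  then have "moreau_env l f xb < ereal (e + \<eta>)" by (simp add: e)
  then obtain w where w: "f w + ereal (1 / (2 * l) * (norm (w - xb))\<^sup>2) < ereal (e + \<eta>)"
    unfolding moreau_env_def INF_less_iff by blast
  define r where "r = norm (w - xb)"
  have "ereal e \<le> f w + ereal (1 / (2 * l) * (norm (w - xb))\<^sup>2)"
    using moreau_env_le[of l f xb w] by (simp only: e)
  then obtain v where v: "f w = ereal v" using w by (cases "f w") auto
  have vless: "v + 1 / (2 * l) * r\<^sup>2 < e + \<eta>" using w by (simp add: v r_def)
  have "1 / (2 * l) * r\<^sup>2 \<ge> 0" using l by simp
  then have "v \<le> c" using vless unfolding \<eta>_def by linarith
  then have r: "r \<ge> \<delta>" using near[of w] by (force simp: v r_def dist_norm)
  define t where "t = s / r"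
  have t: "t > 0" "t < 1" "t * r = s" using r s \<delta> by (auto simp: t_def)
  define y where "y = xb + t *\<^sub>R (w - xb)"
  have "norm (y - xb) = s" using t by (simp add: y_def r_def)
  then have "y \<in> ball xb \<epsilon>" using s by (simp add: dist_norm norm_minus_commute)
  then have "ereal e \<le> f w + ereal (1 / (2 * l) * (norm (w - y))\<^sup>2)"
    using min moreau_env_le[of l f y w] e order_trans by metis
  moreover have "w - y = (1 - t) *\<^sub>R (w - xb)" by (simp add: y_def algebra_simps)
  then have "norm (w - y) = (1 - t) * r" using t by (simp add: r_def)
  ultimately have "e \<le> v + 1 / (2 * l) * ((1 - t) * r)\<^sup>2" by (simp add: v)
  also have "\<dots> \<le> v + 1 / (2 * l) * (r\<^sup>2 - s * r)"
  proof -
    \<comment> \<open>Since (1 - t) r = r - s, the full decrease is 2 s r - s^2; keeping only s r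
      suffices because s \<le> r.\<close>
    have "((1 - t) * r)\<^sup>2 = r\<^sup>2 - s * r - s * (r - s)"
      unfolding t(3)[symmetric] by (simp add: power2_eq_square algebra_simps)
    also have "\<dots> \<le> r\<^sup>2 - s * r" using s r by simp
    finally show ?thesis using l by (intro add_left_mono mult_left_mono) auto
  qed
  also have "\<dots> = v + 1 / (2 * l) * r\<^sup>2 - s * r / (2 * l)"
    by (simp add: diff_divide_distrib)
  also have "\<dots> \<le> v + 1 / (2 * l) * r\<^sup>2 - s * \<delta> / (2 * l)"
    using s r l by (simp add: divide_right_mono)
  also have "\<dots> \<le> v + 1 / (2 * l) * r\<^sup>2 - \<eta>" by (simp add: \<eta>_def)
  finally show False using vless by linarith
qed

lemma strong_local_min_of_moreau_env:
  fixes f :: "'a::real_normed_vector \<Rightarrow> ereal"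
  assumes lsc: "lower_semicontinuous f" and \<sigma>: "\<sigma> > 0" and l: "l > 0"
    and min: "strong_local_min (moreau_env l f) xb (\<sigma> / (1 + \<sigma> * l))"
  shows "strong_local_min f xb \<sigma>"
proof -
  define m where "m = 1 + \<sigma> * l"
  have m: "m > 0" using \<sigma> l by (simp add: m_def add_pos_pos)
  obtain \<epsilon> where fin: "\<bar>moreau_env l f xb\<bar> \<noteq> \<infinity>" and \<epsilon>: "\<epsilon> > 0"
    and grow: "\<And>x. x \<in> ball xb \<epsilon> \<Longrightarrow>
      moreau_env l f x \<ge> moreau_env l f xb + ereal (\<sigma> / m / 2 * (norm (x - xb))\<^sup>2)"
    using min unfolding strong_local_min_def m_def by metis
  have "moreau_env l f xb \<le> moreau_env l f x" if "x \<in> ball xb \<epsilon>" for x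
  proof -
    have "moreau_env l f xb \<le> moreau_env l f xb + ereal (\<sigma> / m / 2 * (norm (x - xb))\<^sup>2)"
      using \<sigma> m by (intro ereal_le_add_self) simp
    then show ?thesis using grow[OF that] by (rule order_trans)
  qed
  then have eq: "moreau_env l f xb = f xb"
    by (rule moreau_env_eq_at_local_min[OF lsc l \<epsilon> fin])
  then obtain f0 where f0: "f xb = ereal f0" using fin by (cases "f xb") auto
  have "f x \<ge> f xb + ereal (\<sigma> / 2 * (norm (x - xb))\<^sup>2)" if x: "x \<in> ball xb (\<epsilon> / m)" for x
  proof -
    define r where "r = norm (x - xb)"
    \<comment> \<open>This \<open>y\<close> makes \<open>x\<close> the minimizer of \<sigma>/2 |w -
      xb|^2 + |w - y|^2 / (2 l) over w, which is the equality case q = \<sigma> l p of the quadratic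
      inequality. The stretch by \<open>m\<close> explains the radius
      \<open>\<epsilon> / m\<close>.\<close>
    define y where "y = xb + m *\<^sub>R (x - xb)"
    have ny: "norm (y - xb) = m * r" using m by (simp add: y_def r_def)
    have "x - y = (- (\<sigma> * l)) *\<^sub>R (x - xb)" by (simp add: y_def m_def algebra_simps)
    then have nx: "norm (x - y) = \<sigma> * l * r" using \<sigma> l by (simp add: r_def)
    have "r < \<epsilon> / m" using x by (simp add: r_def dist_norm norm_minus_commute)
    then have "y \<in> ball xb \<epsilon>"
      using ny m by (simp add: dist_norm norm_minus_commute field_simps)
    from order_trans[OF grow[OF this] moreau_env_le]
    have *: "ereal (f0 + \<sigma> / m / 2 * (m * r)\<^sup>2) \<le> f x + ereal (1 / (2 * l) * (\<sigma> * l * r)\<^sup>2)"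
      unfolding ny nx[symmetric] eq f0 by simp
    have "\<sigma> / m / 2 * (m * r)\<^sup>2 = \<sigma> / 2 * r\<^sup>2 + 1 / (2 * l) * (\<sigma> * l * r)\<^sup>2"
      using m l by (simp add: power2_eq_square) (simp add: m_def field_simps)
    \<comment> \<open>For finite \<open>f x\<close> the common term cancels; \<open>*\<close> rules
      out -\<infinity>, and \<infinity> is trivial.\<close>
    then show ?thesis
      using * by (cases "f x") (auto simp: f0 r_def)
  qed
  then show ?thesis
    unfolding strong_local_min_def using \<sigma> m \<epsilon> f0
    by (intro conjI exI[of _ "\<epsilon> / m"]) auto
qed

theorem theorem4p3:
  fixes \<phi> :: "'a::{real_inner, complete_space} \<Rightarrow> ereal"
    and xb :: 'a
    and \<sigma> :: real
  assumes "\<And>x. \<phi> x \<noteq> -\<infinity>"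
    and "proper_fun \<phi>"
    and "prox_bounded \<phi>"
    and "lower_semicontinuous \<phi>"
    and "xb \<in> dom_ext \<phi>"
    and "\<sigma> > 0"
  shows "(weakly_seq_lsc \<phi> \<longrightarrow>
            strong_local_min \<phi> xb \<sigma> \<longrightarrow>
            (\<forall>\<^sub>F l in at_right 0. strong_local_min (moreau_env l \<phi>) xb (\<sigma> / (1 + \<sigma> * l)))) \<and>
         ((\<forall>\<^sub>F l in at_right 0. prox_map l \<phi> xb \<noteq> {}) \<longrightarrow>
            (\<forall>\<^sub>F l in at_right 0. strong_local_min (moreau_env l \<phi>) xb (\<sigma> / (1 + \<sigma> * l))) \<longrightarrow>
            strong_local_min \<phi> xb \<sigma>) \<and>
         (weakly_seq_lsc \<phi> \<longrightarrow>
            (\<forall>\<^sub>F l in at_right 0. strong_local_min (moreau_env l \<phi>) xb (\<sigma> / (1 + \<sigma> * l))) \<longrightarrow>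
            strong_local_min \<phi> xb \<sigma>)"
proof -
  have "strong_local_min \<phi> xb \<sigma>"
    if "\<forall>\<^sub>F l in at_right 0. strong_local_min (moreau_env l \<phi>) xb (\<sigma> / (1 + \<sigma> * l))"
  proof -
    \<comment> \<open>One positive \<open>l\<close> is enough, and it exists because
      \<open>at_right 0\<close> is a nontrivial filter.\<close>
    have "\<forall>\<^sub>F l in at_right 0.
        l > 0 \<and> strong_local_min (moreau_env l \<phi>) xb (\<sigma> / (1 + \<sigma> * l))"
      using that eventually_at_right_less by (rule eventually_elim2) simp
    then obtain l where "l > 0" "strong_local_min (moreau_env l \<phi>) xb (\<sigma> / (1 + \<sigma> * l))"
      using eventually_happens trivial_limit_at_right_real by blast
    then show ?thesis
      using strong_local_min_of_moreau_env[OF assms(4,6)] by blast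
  qed
  then show ?thesis
    using strong_local_min_moreau_env[OF assms(3)] by blast
qed

end
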